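(* The injective tensor product $C([0,1])\otimes_\vee C([0,1])$ is isomorphic (as a Banach space) to the space of continuous functions on the unit square: $$C([0,1])\otimes_\vee C([0,1])\cong C([0,1]\times[0,1]).$$
   Context: $C([0,1])$ and $C([0,1]\times[0,1])$ denote the Banach spaces of real-valued continuous functions with the sup-norm. For a Banach space $V$ with dual $V^*$, an element $w=\sum_{i=1}^n x_i\otimes y_i$ of the algebraic tensor product $V\otimes V$ is identified with the finite rank operator $x^*\mapsto\sum_{i=1}^n x^*(x_i)y_i$ in the space $\mathcal{B}(V^*,V)$ of bounded linear maps. The injective tensor product $V\otimes_\vee V$ is the closure of $V\otimes V$ in $\mathcal{B}(V^*,V)$ in the operator norm; its norm is $\|w\|_\vee=\sup\{\sum_{i=1}^n x^*(x_i)y^*(y_i):x^*,y^*\in\mathcal{O}_{V^*}\}$ for $w=\sum_i x_i\otimes y_i$, with $\mathcal{O}_{V^*}$ the closed unit ball of $V^*$. *)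

theory Defs
  imports "HOL-Analysis.Analysis"
begin

section \<open>The unit interval as a metric space\<close>

typedef unit_interval = "{0..1::real}"
  morphisms of_unit to_unit
  by (rule exI[of _ 0]) simp

setup_lifting type_definition_unit_interval

instantiation unit_interval :: metric_space
begin

definition dist_unit_interval :: "unit_interval \<Rightarrow> unit_interval \<Rightarrow> real"
  where "dist_unit_interval s t = dist (of_unit s) (of_unit t)"

definition uniformity_unit_interval :: "(unit_interval \<times> unit_interval) filter"
  where "uniformity_unit_interval = (INF e\<in>{0 <..}. principal {(s, t). dist s t < e})"

definition open_unit_interval :: "unit_interval set \<Rightarrow> bool"
  where "open_unit_interval U =
    (\<forall>s\<in>U. eventually (\<lambda>(s', t). s' = s \<longrightarrow> t \<in> U) uniformity)"

instance
proof
  fix s t u :: unit_interval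
  show "dist s t = 0 \<longleftrightarrow> s = t"
    by (simp add: dist_unit_interval_def of_unit_inject)
  show "dist s t \<le> dist s u + dist t u"
    unfolding dist_unit_interval_def by (rule dist_triangle2)
qed (simp_all add: uniformity_unit_interval_def open_unit_interval_def)

end

lemma continuous_on_of_unit: "continuous_on A of_unit"
  unfolding continuous_on_iff dist_unit_interval_def by blast

lemma continuous_on_to_unit: "continuous_on {0..1} to_unit"
  unfolding continuous_on_iff dist_unit_interval_def
  by (metis to_unit_inverse)

lemma compact_UNIV_unit_interval: "compact (UNIV :: unit_interval set)"
proof -
  have "compact (to_unit ` {0..1})"
    by (intro compact_continuous_image continuous_on_to_unit compact_Icc)
  moreover have "to_unit ` {0..1} = UNIV"
    by (metis type_definition.Abs_image type_definition_unit_interval)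
  ultimately show ?thesis by simp
qed

text \<open>
  On a compact space every continuous function is bounded, so the Banach space
  \<^typ>\<open>unit_interval \<Rightarrow>\<^sub>C real\<close> of bounded continuous functions, with the sup-norm, is
  \<open>C([0,1])\<close>, and \<^typ>\<open>(unit_interval \<times> unit_interval) \<Rightarrow>\<^sub>C real\<close> is \<open>C([0,1] \<times> [0,1])\<close>.
\<close>

lemma bcontfun_unit_interval_iff:
  fixes f :: "unit_interval \<Rightarrow> real"
  shows "f \<in> bcontfun \<longleftrightarrow> continuous_on UNIV f"
  using compact_continuous_image[OF _ compact_UNIV_unit_interval, of f] compact_imp_bounded
  by (auto simp: bcontfun_def)

lemma bcontfun_unit_square_iff:
  fixes f :: "unit_interval \<times> unit_interval \<Rightarrow> real"
  shows "f \<in> bcontfun \<longleftrightarrow> continuous_on UNIV f"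
proof -
  have "compact (UNIV :: (unit_interval \<times> unit_interval) set)"
    using compact_Times[OF compact_UNIV_unit_interval compact_UNIV_unit_interval] by simp
  then show ?thesis
    using compact_continuous_image[of UNIV f] compact_imp_bounded by (auto simp: bcontfun_def)
qed

instance bcontfun :: (metric_space, banach) banach ..

section \<open>The injective tensor product\<close>

text \<open>The elementary tensor \<open>x \<otimes> y\<close>, identified with the operator \<open>x\<^sup>* \<mapsto> x\<^sup>*(x) y\<close>.\<close>

lift_definition elementary_tensor ::
    "'v::real_normed_vector \<Rightarrow> 'v \<Rightarrow> ('v \<Rightarrow>\<^sub>L real) \<Rightarrow>\<^sub>L 'v"
  is "\<lambda>x y \<phi>. blinfun_apply \<phi> x *\<^sub>R y"
  by (intro bounded_linear_intros)

definition algebraic_tensor_product ::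
    "(('v::real_normed_vector \<Rightarrow>\<^sub>L real) \<Rightarrow>\<^sub>L 'v) set"
  where "algebraic_tensor_product =
    {w. \<exists>(n::nat) x y. w = (\<Sum>i<n. elementary_tensor (x i) (y i))}"

text \<open>
  The norm of \<^typ>\<open>('v::real_normed_vector \<Rightarrow>\<^sub>L real) \<Rightarrow>\<^sub>L 'v\<close> is the operator norm, and
  \<^const>\<open>closure\<close> refers to the induced topology.
\<close>

definition injective_tensor_product :: "(('v::banach \<Rightarrow>\<^sub>L real) \<Rightarrow>\<^sub>L 'v) set"
  where "injective_tensor_product = closure algebraic_tensor_product"

lemma algebraic_tensor_product_eq_span:
  "algebraic_tensor_product = span (range (\<lambda>(x, y). elementary_tensor x y))"
    (is "?A = span ?E")
proof
  have "elementary_tensor x y \<in> span ?E" for x y :: 'a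
    by (rule span_base, rule range_eqI[of _ _ "(x, y)"], simp)
  then have "(\<Sum>i<n. elementary_tensor (x i) (y i)) \<in> span ?E" for n :: nat and x y :: "nat \<Rightarrow> 'a"
    by (intro span_sum)
  then show "?A \<subseteq> span ?E"
    unfolding algebraic_tensor_product_def by blast
next
  have scale: "c *\<^sub>R elementary_tensor x y = elementary_tensor (c *\<^sub>R x) y" for c x and y :: 'a
    by (transfer, simp add: blinfun.scaleR_right)
  show "span ?E \<subseteq> ?A"
  proof
    fix w assume "w \<in> span ?E"
    then show "w \<in> ?A"
    proof (induction rule: span_induct_alt)
      case base
      show ?case
        unfolding algebraic_tensor_product_def by (auto intro!: exI[of _ 0])
    next
      case (step c e w)
      from step.hyps obtain u v where e: "e = elementary_tensor u v" by auto
      from step.IH obtain n :: nat and x y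
        where w: "w = (\<Sum>i<n. elementary_tensor (x i) (y i))"
        unfolding algebraic_tensor_product_def by auto
      have "c *\<^sub>R e + w =
          (\<Sum>i<Suc n. elementary_tensor ((x(n := c *\<^sub>R u)) i) ((y(n := v)) i))"
        by (simp add: e w scale)
      then show ?case
        unfolding algebraic_tensor_product_def by blast
    qed
  qed
qed

lemma subspace_injective_tensor_product:
  "subspace (injective_tensor_product :: (('v::banach \<Rightarrow>\<^sub>L real) \<Rightarrow>\<^sub>L 'v) set)"
proof -
  let ?A = "algebraic_tensor_product :: (('v \<Rightarrow>\<^sub>L real) \<Rightarrow>\<^sub>L 'v) set"
  have A: "subspace ?A"
    unfolding algebraic_tensor_product_eq_span by (rule subspace_span)
  have "x + y \<in> closure ?A" if "x \<in> closure ?A" "y \<in> closure ?A" for x y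
  proof -
    from that obtain u v where "\<forall>n. u n \<in> ?A" "u \<longlonglongrightarrow> x" "\<forall>n. v n \<in> ?A" "v \<longlonglongrightarrow> y"
      unfolding closure_sequential by auto
    then have "\<forall>n. u n + v n \<in> ?A" "(\<lambda>n. u n + v n) \<longlonglongrightarrow> x + y"
      using subspace_add[OF A] tendsto_add by auto
    then show ?thesis
      unfolding closure_sequential by (intro exI[of _ "\<lambda>n. u n + v n"]) simp
  qed
  moreover have "c *\<^sub>R x \<in> closure ?A" if "x \<in> closure ?A" for c x
  proof -
    from that obtain u where "\<forall>n. u n \<in> ?A" "u \<longlonglongrightarrow> x"
      unfolding closure_sequential by auto
    then have "\<forall>n. c *\<^sub>R u n \<in> ?A" "(\<lambda>n. c *\<^sub>R u n) \<longlonglongrightarrow> c *\<^sub>R x"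
      using subspace_scale[OF A] tendsto_scaleR[OF tendsto_const] by auto
    then show ?thesis
      unfolding closure_sequential by (intro exI[of _ "\<lambda>n. c *\<^sub>R u n"]) simp
  qed
  moreover have "0 \<in> closure ?A"
    using subspace_0[OF A] closure_subset by blast
  ultimately show ?thesis
    unfolding injective_tensor_product_def subspace_def by blast
qed

lemma complete_injective_tensor_product: "complete injective_tensor_product"
  by (simp add: injective_tensor_product_def complete_eq_closed)

section \<open>Isomorphism of Banach spaces\<close>

text \<open>
  The Banach spaces are given as closed linear subspaces \<open>S\<close> and \<open>T\<close> of ambient Banach
  spaces. An isomorphism preserves the whole structure, including the norm.
\<close>

definition banach_isomorphic :: "'a::banach set \<Rightarrow> 'b::banach set \<Rightarrow> bool"
    (infix \<open>\<cong>\<^sub>B\<close> 50)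
  where "S \<cong>\<^sub>B T \<longleftrightarrow>
    (\<exists>f. bij_betw f S T \<and>
      (\<forall>x\<in>S. \<forall>y\<in>S. f (x + y) = f x + f y) \<and>
      (\<forall>c. \<forall>x\<in>S. f (c *\<^sub>R x) = c *\<^sub>R f x) \<and>
      (\<forall>x\<in>S. norm (f x) = norm x))"

end

theory Submission
  imports Defs
begin

text \<open>
  Write \<open>K = [0,1]\<close> and \<open>V = C(K)\<close>. A function \<open>F \<in> C(K \<times> K)\<close> is a continuous family of slices
  \<open>F(\<cdot>, t) \<in> V\<close>, so it acts on functionals slice by slice: it sends \<open>\<phi> \<in> V\<^sup>*\<close> to the function
  \<open>t \<mapsto> \<phi>(F(\<cdot>, t))\<close>. The function \<open>(s, t) \<mapsto> f s * g t\<close> acts as the elementary tensor \<open>f \<otimes> g\<close>.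
  This action is a linear isometry from \<open>C(K \<times> K)\<close> into the operators \<open>V\<^sup>* \<rightarrow> V\<close>
  (\<open>norm_slice_operator\<close>): slices have norm at most that of \<open>F\<close>, and conversely
  point evaluations, which are functionals of norm at most one, recover every value \<open>F(s, t)\<close>.

  The range is exactly \<open>V \<otimes>\<^sub>\<or> V\<close> (\<open>range_slice_operator\<close>). It is complete, hence
  closed, and contains the elementary tensors; so it contains the closure of their span.
  Conversely, by the Stone--Weierstrass theorem (\<open>separated_sum_approximation\<close>), every
  \<open>F\<close> is a uniform limit of finite sums of products \<open>f s * g t\<close>, and by the isometry its operator
  is a norm limit of finite sums of elementary tensors. The required isomorphism is the inverse of
  the action. The argument is the same for every compact metric space \<open>K\<close>.
\<close>

section \<open>Slices and evaluations\<close>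

definition slice ::
    "(('a::metric_space \<times> 'b::metric_space) \<Rightarrow>\<^sub>C real) \<Rightarrow> 'b \<Rightarrow> 'a \<Rightarrow>\<^sub>C real"
  where "slice F t = Bcontfun (\<lambda>s. apply_bcontfun F (s, t))"

lemma apply_slice [simp]: "apply_bcontfun (slice F t) s = apply_bcontfun F (s, t)"
proof -
  have "continuous_on UNIV (\<lambda>s. apply_bcontfun F (s, t))"
    by (rule continuous_on_compose2[of UNIV "apply_bcontfun F"])
      (simp_all add: continuous_on_Pair continuous_on_id continuous_on_const)
  then have "(\<lambda>s. apply_bcontfun F (s, t)) \<in> bcontfun"
    using norm_bounded[of F] by (rule bcontfun_normI)
  then show ?thesis
    by (simp add: slice_def Bcontfun_inverse)
qed

lemma slice_add: "slice (F + G) t = slice F t + slice G t"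
  by (rule bcontfun_eqI) simp

lemma slice_scaleR: "slice (c *\<^sub>R F) t = c *\<^sub>R slice F t"
  by (rule bcontfun_eqI) simp

lemma norm_slice_le: "norm (slice F t) \<le> norm F"
  by (rule norm_bound) (use norm_bounded[of F] in simp)

text \<open>
  Convergence in \<open>C(K)\<close> is uniform convergence, so separate continuity of \<open>F\<close> would not suffice;
  compactness supplies uniform continuity.
\<close>

lemma continuous_on_slice:
  fixes F :: "('a::metric_space \<times> 'b::metric_space) \<Rightarrow>\<^sub>C real"
  assumes "compact (UNIV :: ('a \<times> 'b) set)"
  shows "continuous_on UNIV (slice F)"
proof -
  have "uniformly_continuous_on UNIV (apply_bcontfun F)"
    by (rule compact_uniformly_continuous[OF _ assms]) simp
  show ?thesis
    unfolding continuous_on_iff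
  proof (intro ballI allI impI)
    fix t and e :: real
    assume "e > 0"
    then obtain d where "d > 0"
      and d: "\<And>p q. dist p q < d \<Longrightarrow> dist (apply_bcontfun F p) (apply_bcontfun F q) < e / 2"
      using \<open>uniformly_continuous_on UNIV (apply_bcontfun F)\<close>
      unfolding uniformly_continuous_on_def by (metis UNIV_I half_gt_zero)
    have "dist (slice F t') (slice F t) < e" if "dist t' t < d" for t'
    proof -
      have "dist (slice F t') (slice F t) \<le> e / 2"
        using d[of "(_, t')" "(_, t)"] that
        by (intro dist_bound) (simp add: dist_Pair_Pair less_imp_le)
      with \<open>e > 0\<close> show ?thesis by simp
    qed
    with \<open>d > 0\<close> show "\<exists>d>0. \<forall>t'\<in>UNIV. dist t' t < d \<longrightarrow> dist (slice F t') (slice F t) < e"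
      by blast
  qed
qed

lift_definition point_evaluation :: "'a::metric_space \<Rightarrow> ('a \<Rightarrow>\<^sub>C real) \<Rightarrow>\<^sub>L real"
  is "\<lambda>s f. apply_bcontfun f s"
  by (rule bounded_linear_intro[of _ 1]) (simp_all add: norm_bounded del: real_norm_def)

declare point_evaluation.rep_eq [simp]

lemma norm_point_evaluation_le: "norm (point_evaluation s) \<le> 1"
  by (rule norm_blinfun_bound) (simp_all add: norm_bounded del: real_norm_def)

section \<open>The isometric action on functionals\<close>

text \<open>
  The coercions \<^const>\<open>Bcontfun\<close> and \<^const>\<open>Blinfun\<close> are meaningful only when \<open>t \<mapsto> F(\<cdot>, t)\<close> is
  continuous, which compactness of the product guarantees.
\<close>

definition slice_apply ::
    "(('a::metric_space \<times> 'b::metric_space) \<Rightarrow>\<^sub>C real) \<Rightarrow> (('a \<Rightarrow>\<^sub>C real) \<Rightarrow>\<^sub>L real) \<Rightarrow> 'b \<Rightarrow>\<^sub>C real"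
  where "slice_apply F \<phi> = Bcontfun (\<lambda>t. blinfun_apply \<phi> (slice F t))"

definition slice_operator ::
    "(('a::metric_space \<times> 'b::metric_space) \<Rightarrow>\<^sub>C real) \<Rightarrow> (('a \<Rightarrow>\<^sub>C real) \<Rightarrow>\<^sub>L real) \<Rightarrow>\<^sub>L ('b \<Rightarrow>\<^sub>C real)"
  where "slice_operator F = Blinfun (slice_apply F)"

lemma functional_slice_le: "\<bar>blinfun_apply \<phi> (slice F t)\<bar> \<le> norm F * norm \<phi>"
proof -
  have "\<bar>blinfun_apply \<phi> (slice F t)\<bar> \<le> norm \<phi> * norm (slice F t)"
    using norm_blinfun[of \<phi> "slice F t"] by simp
  also have "\<dots> \<le> norm \<phi> * norm F"
    by (intro mult_left_mono norm_slice_le) simp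
  finally show ?thesis by (simp add: mult.commute)
qed

context
  assumes compact_product: "compact (UNIV :: ('a::metric_space \<times> 'b::metric_space) set)"
begin

lemma apply_slice_apply [simp]:
  fixes F :: "('a \<times> 'b) \<Rightarrow>\<^sub>C real"
  shows "apply_bcontfun (slice_apply F \<phi>) t = blinfun_apply \<phi> (slice F t)"
proof -
  have "(\<lambda>t. blinfun_apply \<phi> (slice F t)) \<in> bcontfun"
    by (rule bcontfun_normI[where b = "norm F * norm \<phi>"])
      (auto intro!: continuous_intros continuous_on_slice compact_product functional_slice_le)
  then show ?thesis
    by (simp add: slice_apply_def Bcontfun_inverse)
qed

lemma apply_slice_operator [simp]:
  fixes F :: "('a \<times> 'b) \<Rightarrow>\<^sub>C real"
  shows "apply_bcontfun (blinfun_apply (slice_operator F) \<phi>) t = blinfun_apply \<phi> (slice F t)"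
proof -
  have "bounded_linear (slice_apply F)"
  proof (rule bounded_linear_intro[where K = "norm F"])
    show "norm (slice_apply F \<phi>) \<le> norm \<phi> * norm F" for \<phi>
      using functional_slice_le[of \<phi> F] by (intro norm_bound) (simp add: mult.commute)
  qed (auto intro!: bcontfun_eqI simp: blinfun.add_left blinfun.scaleR_left)
  then show ?thesis
    by (simp add: slice_operator_def bounded_linear_Blinfun_apply)
qed

lemma slice_operator_add:
  fixes F G :: "('a \<times> 'b) \<Rightarrow>\<^sub>C real"
  shows "slice_operator (F + G) = slice_operator F + slice_operator G"
  by (intro blinfun_eqI bcontfun_eqI) (simp add: slice_add blinfun.add_left blinfun.add_right)

lemma slice_operator_scaleR:
  fixes F :: "('a \<times> 'b) \<Rightarrow>\<^sub>C real"
  shows "slice_operator (c *\<^sub>R F) = c *\<^sub>R slice_operator F"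
  by (intro blinfun_eqI bcontfun_eqI) (simp add: slice_scaleR blinfun.scaleR_left blinfun.scaleR_right)

text \<open>
  Testing the operator on the evaluation at \<open>s\<close>, and its result at \<open>t\<close>, gives back \<open>F(s, t)\<close>;
  no norm is lost since evaluations have norm at most one.
\<close>

lemma norm_slice_operator:
  fixes F :: "('a \<times> 'b) \<Rightarrow>\<^sub>C real"
  shows "norm (slice_operator F) = norm F"
proof (rule antisym)
  show "norm (slice_operator F) \<le> norm F"
    using functional_slice_le[of _ F] by (intro norm_blinfun_bound norm_bound) simp_all
  show "norm F \<le> norm (slice_operator F)"
  proof (rule norm_bound)
    fix p :: "'a \<times> 'b"
    obtain s t where p: "p = (s, t)" by fastforce
    let ?g = "blinfun_apply (slice_operator F) (point_evaluation s)"
    have "norm (apply_bcontfun F p) = norm (apply_bcontfun ?g t)"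
      by (simp add: p)
    also have "\<dots> \<le> norm ?g"
      by (rule norm_bounded)
    also have "\<dots> \<le> norm (slice_operator F) * norm (point_evaluation s)"
      by (rule norm_blinfun)
    also have "\<dots> \<le> norm (slice_operator F)"
      by (simp add: mult_left_le norm_point_evaluation_le)
    finally show "norm (apply_bcontfun F p) \<le> norm (slice_operator F)" .
  qed
qed

lemma bounded_linear_slice_operator:
  "bounded_linear (slice_operator :: (('a \<times> 'b) \<Rightarrow>\<^sub>C real) \<Rightarrow> _)"
  by (rule bounded_linear_intro[where K = 1])
    (simp_all add: slice_operator_add slice_operator_scaleR norm_slice_operator)

end

section \<open>Density of sums of products\<close>

text \<open>
  Sums are generated one product at a time, so that closure under multiplication and the
  translation into tensors are inductions without any indices.
\<close>

inductive_set separated_sums :: "('a::metric_space \<times> 'b::metric_space \<Rightarrow> real) set" where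
  product: "continuous_on UNIV f \<Longrightarrow> continuous_on UNIV g
    \<Longrightarrow> (\<lambda>p. f (fst p) * g (snd p)) \<in> separated_sums"
| add: "u \<in> separated_sums \<Longrightarrow> v \<in> separated_sums \<Longrightarrow> (\<lambda>p. u p + v p) \<in> separated_sums"

lemma continuous_on_separated_sum:
  "u \<in> separated_sums \<Longrightarrow> continuous_on UNIV u"
proof (induction rule: separated_sums.induct)
  case (product f g)
  have "continuous_on UNIV (\<lambda>p. f (fst p))" "continuous_on UNIV (\<lambda>p. g (snd p))"
    using continuous_on_compose2[OF product(1) continuous_on_fst[OF continuous_on_id]]
      continuous_on_compose2[OF product(2) continuous_on_snd[OF continuous_on_id]]
    by simp_all
  then show ?case by (rule continuous_on_mult)
qed (intro continuous_intros)

lemma product_mult_separated_sum: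
  assumes "v \<in> separated_sums" "continuous_on UNIV f" "continuous_on UNIV g"
  shows "(\<lambda>p. (f (fst p) * g (snd p)) * v p) \<in> separated_sums"
  using assms(1)
proof (induction rule: separated_sums.induct)
  case (product f' g')
  have "(\<lambda>p. (\<lambda>s. f s * f' s) (fst p) * (\<lambda>t. g t * g' t) (snd p)) \<in> separated_sums"
    by (intro separated_sums.product continuous_on_mult assms product)
  then show ?case by (simp add: algebra_simps)
next
  case (add u v)
  then show ?case
    using separated_sums.add[OF add.IH] by (simp add: distrib_left)
qed

lemma separated_sums_mult:
  assumes "u \<in> separated_sums" "v \<in> separated_sums"
  shows "(\<lambda>p. u p * v p) \<in> separated_sums"
  using assms(1)
proof (induction rule: separated_sums.induct)
  case (product f g)
  then show ?case by (rule product_mult_separated_sum[OF assms(2)])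
next
  case (add u u')
  then show ?case
    using separated_sums.add[OF add.IH] by (simp add: distrib_right)
qed

text \<open>
  Distances to a coordinate of one of two distinct points separate them, as the points differ in
  some coordinate.
\<close>

lemma separated_sum_approximation:
  fixes F :: "'a::metric_space \<times> 'b::metric_space \<Rightarrow> real"
  assumes "compact (UNIV :: ('a \<times> 'b) set)" "continuous_on UNIV F" "0 < e"
  obtains u where "u \<in> separated_sums" "\<And>p. \<bar>F p - u p\<bar> < e"
proof -
  interpret function_ring_on "separated_sums :: ('a \<times> 'b \<Rightarrow> real) set" UNIV
  proof
    show "(\<lambda>p. c) \<in> (separated_sums :: ('a \<times> 'b \<Rightarrow> real) set)" for c
      using separated_sums.product[of "\<lambda>_. c" "\<lambda>_. 1"] by simp
    fix p q :: "'a \<times> 'b"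
    assume "p \<noteq> q"
    let ?f = "\<lambda>r. dist (fst r) (fst p)" and ?g = "\<lambda>r. dist (snd r) (snd p)"
    have "?f \<in> (separated_sums :: ('a \<times> 'b \<Rightarrow> real) set)"
      using separated_sums.product[of "\<lambda>s. dist s (fst p)" "\<lambda>_. 1"] by (simp add: continuous_intros)
    moreover have "?g \<in> (separated_sums :: ('a \<times> 'b \<Rightarrow> real) set)"
      using separated_sums.product[of "\<lambda>_. 1" "\<lambda>t. dist t (snd p)"] by (simp add: continuous_intros)
    moreover have "?f p \<noteq> ?f q \<or> ?g p \<noteq> ?g q"
      using \<open>p \<noteq> q\<close> by (auto simp: prod_eq_iff)
    ultimately show "\<exists>u\<in>separated_sums. u p \<noteq> u q"
      using bexI[of "\<lambda>u. u p \<noteq> u q" ?f separated_sums] bexI[of "\<lambda>u. u p \<noteq> u q" ?g separated_sums]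
      by argo
  qed (auto intro: assms continuous_on_separated_sum separated_sums.add separated_sums_mult)
  show thesis
    using Stone_Weierstrass_basic[OF assms(2,3)] that by auto
qed

section \<open>The range of the action\<close>

lemma bcontfun_compact:
  fixes f :: "'a::topological_space \<Rightarrow> 'b::metric_space"
  assumes "compact (UNIV :: 'a set)" "continuous_on UNIV f"
  shows "f \<in> bcontfun"
  using assms compact_continuous_image[of UNIV f] compact_imp_bounded by (auto simp: bcontfun_def)

lemma slice_operator_product:
  fixes f g :: "'a::metric_space \<Rightarrow>\<^sub>C real" and F :: "('a \<times> 'a) \<Rightarrow>\<^sub>C real"
  assumes "compact (UNIV :: ('a \<times> 'a) set)"
    and F: "\<And>p. apply_bcontfun F p = apply_bcontfun f (fst p) * apply_bcontfun g (snd p)"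
  shows "slice_operator F = elementary_tensor f g"
proof (intro blinfun_eqI bcontfun_eqI)
  fix \<phi> t
  have "slice F t = apply_bcontfun g t *\<^sub>R f"
    by (rule bcontfun_eqI) (simp add: F)
  then show "apply_bcontfun (blinfun_apply (slice_operator F) \<phi>) t =
      apply_bcontfun (blinfun_apply (elementary_tensor f g) \<phi>) t"
    by (simp add: apply_slice_operator[OF assms(1)] elementary_tensor.rep_eq blinfun.scaleR_right)
qed

context
  assumes compact_base: "compact (UNIV :: 'a::metric_space set)"
begin

lemma compact_square: "compact (UNIV :: ('a \<times> 'a) set)"
  using compact_Times[OF compact_base compact_base] by simp

lemma separated_sum_operator:
  fixes u :: "'a \<times> 'a \<Rightarrow> real"
  assumes "u \<in> separated_sums"
  shows "\<exists>F. apply_bcontfun F = u \<and> slice_operator F \<in> algebraic_tensor_product"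
  using assms
proof (induction rule: separated_sums.induct)
  case (product f g)
  then obtain f' g' where f': "f = apply_bcontfun f'" and g': "g = apply_bcontfun g'"
    by (metis bcontfunE bcontfun_compact[OF compact_base])
  have "(\<lambda>p. f (fst p) * g (snd p)) \<in> bcontfun"
    using product
    by (intro bcontfun_compact compact_square continuous_on_separated_sum separated_sums.product)
  then obtain F where F: "(\<lambda>p. f (fst p) * g (snd p)) = apply_bcontfun F"
    by (rule bcontfunE)
  have "slice_operator F = elementary_tensor f' g'"
    using fun_cong[OF F] by (intro slice_operator_product compact_square) (simp add: f' g')
  then have "slice_operator F \<in> algebraic_tensor_product"
    unfolding algebraic_tensor_product_eq_span by (auto intro!: span_base)
  with F show ?case by metis
next
  case (add u v)
  then obtain F G where "apply_bcontfun F = u" "apply_bcontfun G = v"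
    and "slice_operator F \<in> algebraic_tensor_product" "slice_operator G \<in> algebraic_tensor_product"
    by blast
  then have "apply_bcontfun (F + G) = (\<lambda>p. u p + v p)"
    and "slice_operator (F + G) \<in> algebraic_tensor_product"
    unfolding algebraic_tensor_product_eq_span
    by (auto simp: slice_operator_add[OF compact_square] span_add)
  then show ?case by blast
qed

text \<open>
  Both inclusions rest on the isometry: it transports completeness to the range, and it turns
  uniform approximation of functions into norm approximation of operators.
\<close>

lemma range_slice_operator:
  "range (slice_operator :: (('a \<times> 'a) \<Rightarrow>\<^sub>C real) \<Rightarrow> _) = injective_tensor_product"
    (is "range ?\<Psi> = _")
proof
  note linear = bounded_linear_slice_operator[OF compact_square]
  show "range ?\<Psi> \<subseteq> injective_tensor_product"
    unfolding injective_tensor_product_def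
  proof (clarsimp simp: closure_approachable)
    fix F :: "('a \<times> 'a) \<Rightarrow>\<^sub>C real" and e :: real
    assume "0 < e"
    then obtain u where u: "u \<in> separated_sums" "\<And>p. \<bar>apply_bcontfun F p - u p\<bar> < e / 2"
      using separated_sum_approximation[OF compact_square, of F "e / 2"] by auto
    then obtain G where G: "apply_bcontfun G = u" "?\<Psi> G \<in> algebraic_tensor_product"
      using separated_sum_operator by blast
    have "dist (?\<Psi> G) (?\<Psi> F) = norm (?\<Psi> (G - F))"
      by (simp add: dist_norm linear_diff[OF bounded_linear.linear[OF linear]])
    also have "\<dots> = norm (G - F)"
      by (rule norm_slice_operator[OF compact_square])
    also have "\<dots> \<le> e / 2"
      using u(2) by (intro norm_bound) (simp add: G(1) abs_minus_commute less_imp_le)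
    finally show "\<exists>w\<in>algebraic_tensor_product. dist w (?\<Psi> F) < e"
      using G(2) \<open>0 < e\<close> by force
  qed
  have "complete (range ?\<Psi>)"
    by (rule complete_isometric_image[OF zero_less_one subspace_UNIV linear])
      (simp_all add: norm_slice_operator[OF compact_square] complete_UNIV)
  moreover have "elementary_tensor f g \<in> range ?\<Psi>" for f g
  proof -
    have "(\<lambda>p. apply_bcontfun f (fst p) * apply_bcontfun g (snd p)) \<in> bcontfun"
      by (intro bcontfun_compact compact_square continuous_on_separated_sum separated_sums.product
          continuous_on_apply_bcontfun)
    then obtain F where "(\<lambda>p. apply_bcontfun f (fst p) * apply_bcontfun g (snd p)) = apply_bcontfun F"
      by (rule bcontfunE)
    from slice_operator_product[OF compact_square fun_cong[OF this, symmetric]]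
    show ?thesis by (metis rangeI)
  qed
  then have "algebraic_tensor_product \<subseteq> range ?\<Psi>"
    unfolding algebraic_tensor_product_eq_span
    by (intro span_minimal linear_subspace_image bounded_linear.linear[OF linear] subspace_UNIV) auto
  ultimately show "injective_tensor_product \<subseteq> range ?\<Psi>"
    unfolding injective_tensor_product_def by (intro closure_minimal complete_imp_closed)
qed

lemma injective_tensor_product_bcontfun:
  "(injective_tensor_product :: ((('a \<Rightarrow>\<^sub>C real) \<Rightarrow>\<^sub>L real) \<Rightarrow>\<^sub>L ('a \<Rightarrow>\<^sub>C real)) set)
    \<cong>\<^sub>B (UNIV :: (('a \<times> 'a) \<Rightarrow>\<^sub>C real) set)"
proof -
  let ?\<Psi> = "slice_operator :: (('a \<times> 'a) \<Rightarrow>\<^sub>C real) \<Rightarrow> _"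
  note linear = bounded_linear_slice_operator[OF compact_square]
  have "inj ?\<Psi>"
  proof (rule injI)
    fix F G :: "('a \<times> 'a) \<Rightarrow>\<^sub>C real"
    assume "?\<Psi> F = ?\<Psi> G"
    then have "norm (F - G) = 0"
      using norm_slice_operator[OF compact_square, of "F - G"]
      by (simp add: linear_diff[OF bounded_linear.linear[OF linear]])
    then show "F = G" by simp
  qed
  then have inv: "inv ?\<Psi> (?\<Psi> F) = F" for F
    by simp
  have "bij_betw ?\<Psi> UNIV injective_tensor_product"
    using \<open>inj ?\<Psi>\<close> range_slice_operator by (simp add: bij_betw_def)
  then have bij: "bij_betw (inv ?\<Psi>) injective_tensor_product UNIV"
    by (rule bij_betw_inv_into)
  show ?thesis
    unfolding banach_isomorphic_def range_slice_operator[symmetric]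
  proof (intro exI[of _ "inv ?\<Psi>"] conjI)
    show "bij_betw (inv ?\<Psi>) (range ?\<Psi>) UNIV"
      using bij by (simp add: range_slice_operator)
    show "\<forall>v\<in>range ?\<Psi>. \<forall>w\<in>range ?\<Psi>. inv ?\<Psi> (v + w) = inv ?\<Psi> v + inv ?\<Psi> w"
      by (auto simp: inv slice_operator_add[OF compact_square, symmetric])
    show "\<forall>c. \<forall>w\<in>range ?\<Psi>. inv ?\<Psi> (c *\<^sub>R w) = c *\<^sub>R inv ?\<Psi> w"
      by (auto simp: inv slice_operator_scaleR[OF compact_square, symmetric])
    show "\<forall>w\<in>range ?\<Psi>. norm (inv ?\<Psi> w) = norm w"
      by (auto simp: inv norm_slice_operator[OF compact_square])
  qed
qed

end

theorem proposition43:
  shows "(injective_tensor_product ::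
            (((unit_interval \<Rightarrow>\<^sub>C real) \<Rightarrow>\<^sub>L real) \<Rightarrow>\<^sub>L (unit_interval \<Rightarrow>\<^sub>C real)) set)
         \<cong>\<^sub>B (UNIV :: ((unit_interval \<times> unit_interval) \<Rightarrow>\<^sub>C real) set)"
  by (rule injective_tensor_product_bcontfun[OF compact_UNIV_unit_interval])

end
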